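(* Let $b_1,b_2$ be distinct real numbers with $0<b_1,b_2<1$, and let $u(x,y)$, $x,y=1,2,\dots$, be a real function. Let $\Phi(x,y)$, $x,y=0,1,2,\dots$, be the solution of $$\Phi(x+1,y+1)-b_1\Phi(x,y+1)-b_2\Phi(x+1,y)+(b_1+b_2-1)\Phi(x,y)=u(x+1,y+1),\qquad x,y=0,1,2,\dots,$$ with $\Phi(x,0)=\Phi(0,y)=0$ for all $x,y\ge0$. For $X,Y\in\mathbb Z_{\ge0}$, take a reversed random path $\mathcal T_-$ leaving $(X+1,Y)$ to the left in the horizontal direction and another reversed random path $\mathcal T_|$ leaving $(X,Y+1)$ down in the vertical direction. Then $$\Phi(X,Y)=\mathbb E\left[\sum_{x=1}^X\sum_{y=1}^Y u(x,y)\,\mathcal I_{\mathrm{between}}(x,y)\right],$$ where $$\mathcal I_{\mathrm{between}}(x,y)=\mathbf 1_{(x,y)\text{ is weakly below }\mathcal T_-}+\mathbf 1_{(x,y)\text{ is weakly to the left from }\mathcal T_|}-1.$$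
   Context: **Reversed random path.** This is a random lattice path in $\mathbb Z^2$ moving by unit steps to the left or down, with memory of its current direction. When the path arrives at a lattice point by a horizontal step (moving to the left), then, independently of the past, the next step is again to the left with probability $b_1$ and down with probability $1-b_1$. When the path arrives at a lattice point by a vertical step (moving down), the next step is again down with probability $b_2$ and to the left with probability $1-b_2$. "Leaving $(X+1,Y)$ to the left" means that the first step is deterministic, from $(X+1,Y)$ to $(X,Y)$; "leaving $(X,Y+1)$ down" means that the first step is from $(X,Y+1)$ to $(X,Y)$. The paths $\mathcal T_-,\mathcal T_|$ are defined on a common probability space. **Weakly below / to the left.** View a path $\mathcal T$ as a continuous curve in the plane made of unit segments. A lattice point $(x,y)$ is *weakly below* $\mathcal T$ if some point of the open square $(x-\frac12,x+\frac12)\times(y-\frac12,y+\frac12)$ is below a point of the path (i.e. has a smaller vertical coordinate and the same horizontal coordinate). It is *weakly to the left* from $\mathcal T$ if some point of this open square is to the left of a point of the path (i.e. has a smaller horizontal coordinate and the same vertical coordinate). *)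

theory Defs
  imports "HOL-Probability.Probability"
begin

definition step_left :: "int \<times> int \<Rightarrow> int \<times> int" where
  "step_left p = (fst p - 1, snd p)"

definition step_down :: "int \<times> int \<Rightarrow> int \<times> int" where
  "step_down p = (fst p, snd p - 1)"

text \<open>
  The reversed random path as a discrete-time process \<open>T\<close> on the probability space \<open>M\<close>, with
  deterministic first step from \<open>p\<close> to \<open>q\<close>. The law is prescribed by conditioning each step on the
  whole history \<open>T 0 = h 0, \<dots>, T (n+1) = h (n+1)\<close> of the path; the direction in which the path
  arrives at \<open>h (n+1)\<close> is read off from the last two points of the history.
\<close>

definition reversed_random_path ::
  "'a measure \<Rightarrow> real \<Rightarrow> real \<Rightarrow> int \<times> int \<Rightarrow> int \<times> int \<Rightarrow> (nat \<Rightarrow> 'a \<Rightarrow> int \<times> int) \<Rightarrow> bool" where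
  "reversed_random_path M b1 b2 p q T \<longleftrightarrow>
     (\<forall>n. T n \<in> measurable M (count_space UNIV)) \<and>
     (\<forall>\<omega>\<in>space M. T 0 \<omega> = p \<and> T 1 \<omega> = q) \<and>
     (\<forall>\<omega>\<in>space M. \<forall>n. T (Suc n) \<omega> = step_left (T n \<omega>) \<or> T (Suc n) \<omega> = step_down (T n \<omega>)) \<and>
     (\<forall>n h. \<P>(\<omega> in M. \<forall>i\<le>Suc n. T i \<omega> = h i) > 0 \<longrightarrow>
        (h (Suc n) = step_left (h n) \<longrightarrow>
           \<P>(\<omega> in M. T (Suc (Suc n)) \<omega> = step_left (h (Suc n)) \<bar> \<forall>i\<le>Suc n. T i \<omega> = h i) = b1 \<and>
           \<P>(\<omega> in M. T (Suc (Suc n)) \<omega> = step_down (h (Suc n)) \<bar> \<forall>i\<le>Suc n. T i \<omega> = h i) = 1 - b1) \<and>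
        (h (Suc n) = step_down (h n) \<longrightarrow>
           \<P>(\<omega> in M. T (Suc (Suc n)) \<omega> = step_down (h (Suc n)) \<bar> \<forall>i\<le>Suc n. T i \<omega> = h i) = b2 \<and>
           \<P>(\<omega> in M. T (Suc (Suc n)) \<omega> = step_left (h (Suc n)) \<bar> \<forall>i\<le>Suc n. T i \<omega> = h i) = 1 - b2))"

definition plane_point :: "int \<times> int \<Rightarrow> real \<times> real" where
  "plane_point p = (real_of_int (fst p), real_of_int (snd p))"

definition curve :: "(nat \<Rightarrow> int \<times> int) \<Rightarrow> (real \<times> real) set" where
  "curve t = (\<Union>n. closed_segment (plane_point (t n)) (plane_point (t (Suc n))))"

definition lattice_square :: "int \<times> int \<Rightarrow> (real \<times> real) set" where
  "lattice_square z =
     {real_of_int (fst z) - 1/2 <..< real_of_int (fst z) + 1/2} \<times>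
     {real_of_int (snd z) - 1/2 <..< real_of_int (snd z) + 1/2}"

definition weakly_below :: "int \<times> int \<Rightarrow> (real \<times> real) set \<Rightarrow> bool" where
  "weakly_below z C \<longleftrightarrow> (\<exists>s\<in>lattice_square z. \<exists>c\<in>C. fst s = fst c \<and> snd s < snd c)"

definition weakly_left :: "int \<times> int \<Rightarrow> (real \<times> real) set \<Rightarrow> bool" where
  "weakly_left z C \<longleftrightarrow> (\<exists>s\<in>lattice_square z. \<exists>c\<in>C. snd s = snd c \<and> fst s < fst c)"

text \<open>The value may be \<open>-1\<close>, \<open>0\<close> or \<open>1\<close>.\<close>

definition I_between :: "(nat \<Rightarrow> int \<times> int) \<Rightarrow> (nat \<Rightarrow> int \<times> int) \<Rightarrow> nat \<Rightarrow> nat \<Rightarrow> real" where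
  "I_between tH tV x y =
     of_bool (weakly_below (int x, int y) (curve tH)) +
     of_bool (weakly_left (int x, int y) (curve tV)) - 1"

end

theory Submission
  imports Defs
begin

text \<open>
  By linearity it suffices to identify the kernel \<open>E[I_between(x, y)]\<close> as the Green function of the
  four-point equation. Along a path going left and down, weak position is a statement about the
  lattice points visited: \<open>(x, y)\<close> is weakly below the path iff the path visits column \<open>x\<close> at height
  at least \<open>y\<close>, and weakly to the left iff it visits row \<open>y\<close> at abscissa at least \<open>x\<close>
  (\<open>weakly_below_curve_iff\<close>, \<open>weakly_left_curve_iff\<close>). Both are hitting events.

  The pair (position, direction of arrival) is a Markov chain, so a hitting probability is a pair of
  functions \<open>gh\<close>, \<open>gv\<close>, one for each direction of arrival, coupled by conditioning on the next step.
  Conversely, once the path is left or below \<open>(x, y)\<close> nothing can be hit any more, so the chain is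
  decided after a bounded number of steps and the coupled equations determine the probabilities
  (\<open>hitting_probability\<close>).

  Write \<open>H\<close>, \<open>H'\<close> for the probabilities of hitting the column after a horizontal or a vertical
  arrival at \<open>(x + i, y + j)\<close>. The first equation expresses \<open>H'(i, j - 1)\<close> through \<open>H\<close>; putting this
  into the second equation eliminates \<open>H'\<close>, and what is left for \<open>H\<close> alone is exactly the homogeneous
  four-point equation (\<open>hit_along_recurrence\<close>). Reflection in the diagonal, which exchanges \<open>b1\<close> and
  \<open>b2\<close>, gives the same equation for the row probability \<open>V\<close> after a vertical arrival. Constants also
  solve it, hence so does \<open>G = H + V - 1\<close>. The subtracted \<open>1\<close> gives \<open>G\<close> the boundary values of the
  Green function: \<open>H(0, j) = 1\<close> and \<open>V(0, j) = b2^j\<close> give \<open>G(0, j) = b2^j\<close>, and likewise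
  \<open>G(i, 0) = b1^i\<close>. These are the values produced by a unit source at the origin and zero values to
  the left and below, so convolving \<open>u\<close> with \<open>G\<close> gives \<open>\<Phi>\<close> (\<open>four_point_solution\<close>).
\<close>

section \<open>Weak position and visited lattice points\<close>

text \<open>
  A horizontal unit segment that enters the open strip of half-width \<open>1/2\<close> around column \<open>x\<close> has an
  endpoint on that column, at the same height. On a vertical segment of the column, a point higher
  than \<open>y - 1/2\<close> forces the upper endpoint to have height at least \<open>y\<close>, by integrality.
\<close>

lemma weakly_below_curve_iff:
  assumes steps: "\<And>n. t (Suc n) = step_left (t n) \<or> t (Suc n) = step_down (t n)"
  shows "weakly_below (x, y) (curve t) \<longleftrightarrow> (\<exists>n. fst (t n) = x \<and> y \<le> snd (t n))"
proof
  assume "weakly_below (x, y) (curve t)"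
  then obtain s c where s: "s \<in> lattice_square (x, y)" and c: "c \<in> curve t"
    and eq: "fst s = fst c" and lt: "snd s < snd c"
    unfolding weakly_below_def by blast
  have f: "x - 1/2 < fst c" "fst c < x + 1/2" and g: "y - 1/2 < snd c"
    using s eq lt by (auto simp: lattice_square_def mem_Times_iff)
  obtain n where "c \<in> closed_segment (plane_point (t n)) (plane_point (t (Suc n)))"
    using c unfolding curve_def by blast
  then obtain w where w: "0 \<le> w" "w \<le> 1"
    and cw: "c = (1 - w) *\<^sub>R plane_point (t n) + w *\<^sub>R plane_point (t (Suc n))"
    unfolding in_segment by blast
  show "\<exists>n. fst (t n) = x \<and> y \<le> snd (t n)"
    using steps[of n]
  proof
    assume st: "t (Suc n) = step_left (t n)"
    have fc: "fst c = fst (t n) - w" and gc: "snd c = snd (t n)"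
      unfolding cw st by (simp_all add: plane_point_def step_left_def algebra_simps)
    have "y \<le> snd (t n)" using g gc by linarith
    moreover have "fst (t n) = x \<or> fst (t n) = x + 1"
      using f fc w by linarith
    ultimately show ?thesis
    proof (elim disjE)
      assume "fst (t n) = x + 1" "y \<le> snd (t n)"
      then have "fst (t (Suc n)) = x" "y \<le> snd (t (Suc n))"
        by (simp_all add: st step_left_def)
      then show ?thesis by blast
    qed blast
  next
    assume st: "t (Suc n) = step_down (t n)"
    have fc: "fst c = fst (t n)" and gc: "snd c = snd (t n) - w"
      unfolding cw st by (simp_all add: plane_point_def step_down_def algebra_simps)
    have "y \<le> snd (t n)" using g gc w by linarith
    moreover have "fst (t n) = x" using f fc by linarith
    ultimately show ?thesis by blast
  qed
next
  assume "\<exists>n. fst (t n) = x \<and> y \<le> snd (t n)"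
  then obtain n where n: "fst (t n) = x" "y \<le> snd (t n)" by blast
  have "plane_point (t n) \<in> curve t"
    unfolding curve_def by blast
  \<comment> \<open>The witness lies strictly below height \<open>y\<close>, so that a path point at height exactly \<open>y\<close> suffices.\<close>
  moreover have "(real_of_int x, real_of_int y - 1/4) \<in> lattice_square (x, y)"
    by (simp add: lattice_square_def)
  ultimately show "weakly_below (x, y) (curve t)"
    unfolding weakly_below_def using n
    by (intro bexI[of _ "(real_of_int x, real_of_int y - 1/4)"] bexI[of _ "plane_point (t n)"])
      (auto simp: plane_point_def)
qed

lemma curve_swap: "curve (prod.swap \<circ> t) = prod.swap ` curve t"
proof -
  have "linear (prod.swap :: real \<times> real \<Rightarrow> real \<times> real)"
    by (intro linearI) (auto simp: prod_eq_iff)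
  moreover have "plane_point (prod.swap p) = prod.swap (plane_point p)" for p
    by (simp add: plane_point_def)
  ultimately show ?thesis
    by (simp add: curve_def image_UN closed_segment_linear_image)
qed

lemma weakly_left_iff_weakly_below_swap:
  "weakly_left (x, y) C \<longleftrightarrow> weakly_below (y, x) (prod.swap ` C)"
proof
  assume "weakly_left (x, y) C"
  then obtain s c where "s \<in> lattice_square (x, y)" "c \<in> C" "snd s = snd c" "fst s < fst c"
    unfolding weakly_left_def by blast
  then show "weakly_below (y, x) (prod.swap ` C)"
    unfolding weakly_below_def
    by (intro bexI[of _ "prod.swap s"] bexI[of _ "prod.swap c"])
      (auto simp: lattice_square_def mem_Times_iff)
next
  assume "weakly_below (y, x) (prod.swap ` C)"
  then obtain s c where "s \<in> lattice_square (y, x)" "c \<in> C" "fst s = snd c" "snd s < fst c"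
    unfolding weakly_below_def by auto
  then show "weakly_left (x, y) C"
    unfolding weakly_left_def
    by (intro bexI[of _ "prod.swap s"] bexI[of _ c])
      (auto simp: lattice_square_def mem_Times_iff)
qed

lemma weakly_left_curve_iff:
  assumes steps: "\<And>n. t (Suc n) = step_left (t n) \<or> t (Suc n) = step_down (t n)"
  shows "weakly_left (x, y) (curve t) \<longleftrightarrow> (\<exists>n. snd (t n) = y \<and> x \<le> fst (t n))"
proof -
  have "(prod.swap \<circ> t) (Suc n) = step_left ((prod.swap \<circ> t) n) \<or>
        (prod.swap \<circ> t) (Suc n) = step_down ((prod.swap \<circ> t) n)" for n
    using steps[of n] by (auto simp: step_left_def step_down_def)
  from weakly_below_curve_iff[of "prod.swap \<circ> t", OF this] show ?thesis
    by (simp add: weakly_left_iff_weakly_below_swap flip: curve_swap)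
qed

section \<open>Hitting probabilities as harmonic functions\<close>

lemma step_left_neq_step_down: "step_left p \<noteq> step_down p"
  by (auto simp: step_left_def step_down_def)

lemma reversed_random_path_step:
  assumes "reversed_random_path M b1 b2 p q T" "\<omega> \<in> space M"
  shows "T (Suc n) \<omega> = step_left (T n \<omega>) \<or> T (Suc n) \<omega> = step_down (T n \<omega>)"
  using assms unfolding reversed_random_path_def by blast

lemma reversed_random_path_measurable:
  assumes "reversed_random_path M b1 b2 p q T"
  shows "T n \<in> measurable M (count_space UNIV)"
  using assms unfolding reversed_random_path_def by blast

lemma reversed_random_path_visits_sets:
  assumes "reversed_random_path M b1 b2 p q T"
  shows "{\<omega> \<in> space M. \<exists>n. T n \<omega> \<in> A} \<in> sets M"
proof -
  have "{\<omega> \<in> space M. \<exists>n. T n \<omega> \<in> A} = (\<Union>n. T n -` A \<inter> space M)"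
    by blast
  moreover have "(\<Union>n. T n -` A \<inter> space M) \<in> sets M"
    using reversed_random_path_measurable[OF assms]
    by (intro sets.countable_UN image_subsetI measurable_sets) auto
  ultimately show ?thesis by (simp only:)
qed

text \<open>
  The chain rule for the law of the path. Stated with products, it also covers histories of
  probability zero, on which the conditional law is not prescribed.
\<close>

lemma reversed_random_path_extend:
  assumes prob: "prob_space M"
    and path: "reversed_random_path M b1 b2 p q T"
  shows "h (Suc n) = step_left (h n) \<Longrightarrow>
      \<P>(\<omega> in M. (\<forall>i\<le>Suc n. T i \<omega> = h i) \<and> T (Suc (Suc n)) \<omega> = step_left (h (Suc n)))
        = \<P>(\<omega> in M. \<forall>i\<le>Suc n. T i \<omega> = h i) * b1"
    and "h (Suc n) = step_left (h n) \<Longrightarrow>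
      \<P>(\<omega> in M. (\<forall>i\<le>Suc n. T i \<omega> = h i) \<and> T (Suc (Suc n)) \<omega> = step_down (h (Suc n)))
        = \<P>(\<omega> in M. \<forall>i\<le>Suc n. T i \<omega> = h i) * (1 - b1)"
    and "h (Suc n) = step_down (h n) \<Longrightarrow>
      \<P>(\<omega> in M. (\<forall>i\<le>Suc n. T i \<omega> = h i) \<and> T (Suc (Suc n)) \<omega> = step_down (h (Suc n)))
        = \<P>(\<omega> in M. \<forall>i\<le>Suc n. T i \<omega> = h i) * b2"
    and "h (Suc n) = step_down (h n) \<Longrightarrow>
      \<P>(\<omega> in M. (\<forall>i\<le>Suc n. T i \<omega> = h i) \<and> T (Suc (Suc n)) \<omega> = step_left (h (Suc n)))
        = \<P>(\<omega> in M. \<forall>i\<le>Suc n. T i \<omega> = h i) * (1 - b2)"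
proof -
  interpret prob_space M by (rule prob)
  let ?H = "\<lambda>\<omega>. \<forall>i\<le>Suc n. T i \<omega> = h i"
  have [measurable]: "T n \<in> measurable M (count_space UNIV)" for n
    using path by (rule reversed_random_path_measurable)
  have mult: "\<P>(\<omega> in M. ?H \<omega> \<and> T (Suc (Suc n)) \<omega> = r) = \<P>(\<omega> in M. ?H \<omega>) * c"
    if "\<P>(\<omega> in M. ?H \<omega>) > 0 \<Longrightarrow> \<P>(\<omega> in M. T (Suc (Suc n)) \<omega> = r \<bar> ?H \<omega>) = c" for r c
  proof (cases "\<P>(\<omega> in M. ?H \<omega>) = 0")
    case True
    have "\<P>(\<omega> in M. ?H \<omega> \<and> T (Suc (Suc n)) \<omega> = r) \<le> \<P>(\<omega> in M. ?H \<omega>)"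
      by (intro finite_measure_mono) auto
    with True show ?thesis
      by (simp add: measure_le_0_iff)
  next
    case False
    then have pos: "\<P>(\<omega> in M. ?H \<omega>) > 0"
      by (simp add: zero_less_measure_iff)
    from that[OF this] pos show ?thesis
      by (auto simp: cond_prob_def field_simps conj_commute)
  qed
  have law: "\<P>(\<omega> in M. ?H \<omega>) > 0 \<Longrightarrow>
        (h (Suc n) = step_left (h n) \<longrightarrow>
           \<P>(\<omega> in M. T (Suc (Suc n)) \<omega> = step_left (h (Suc n)) \<bar> ?H \<omega>) = b1 \<and>
           \<P>(\<omega> in M. T (Suc (Suc n)) \<omega> = step_down (h (Suc n)) \<bar> ?H \<omega>) = 1 - b1) \<and>
        (h (Suc n) = step_down (h n) \<longrightarrow>
           \<P>(\<omega> in M. T (Suc (Suc n)) \<omega> = step_down (h (Suc n)) \<bar> ?H \<omega>) = b2 \<and>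
           \<P>(\<omega> in M. T (Suc (Suc n)) \<omega> = step_left (h (Suc n)) \<bar> ?H \<omega>) = 1 - b2)"
    using path unfolding reversed_random_path_def by blast
  show "h (Suc n) = step_left (h n) \<Longrightarrow>
      \<P>(\<omega> in M. ?H \<omega> \<and> T (Suc (Suc n)) \<omega> = step_left (h (Suc n))) = \<P>(\<omega> in M. ?H \<omega>) * b1"
    by (rule mult) (use law in blast)
  show "h (Suc n) = step_left (h n) \<Longrightarrow>
      \<P>(\<omega> in M. ?H \<omega> \<and> T (Suc (Suc n)) \<omega> = step_down (h (Suc n))) = \<P>(\<omega> in M. ?H \<omega>) * (1 - b1)"
    by (rule mult) (use law in blast)
  show "h (Suc n) = step_down (h n) \<Longrightarrow>
      \<P>(\<omega> in M. ?H \<omega> \<and> T (Suc (Suc n)) \<omega> = step_down (h (Suc n))) = \<P>(\<omega> in M. ?H \<omega>) * b2"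
    by (rule mult) (use law in blast)
  show "h (Suc n) = step_down (h n) \<Longrightarrow>
      \<P>(\<omega> in M. ?H \<omega> \<and> T (Suc (Suc n)) \<omega> = step_left (h (Suc n))) = \<P>(\<omega> in M. ?H \<omega>) * (1 - b2)"
    by (rule mult) (use law in blast)
qed

text \<open>
  Candidate hitting probabilities of a target \<open>A\<close>. The direction of arrival is part of the Markov
  state, hence two functions: \<open>gh\<close> after a step to the left and \<open>gv\<close> after a step down. The dead set
  \<open>D\<close> consists of points from which \<open>A\<close> is out of reach; it is closed under steps. The rank bounds the
  number of steps before the path enters \<open>A\<close> or \<open>D\<close>, so the functions are determined by
  their values on these two sets through a finite recursion.
\<close>

locale absorbed_harmonic =
  fixes b1 b2 :: real
    and A D :: "(int \<times> int) set"
    and gh gv :: "int \<times> int \<Rightarrow> real"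
    and rank :: "int \<times> int \<Rightarrow> nat"
  assumes on_target: "z \<in> A \<Longrightarrow> gh z = 1 \<and> gv z = 1"
    and on_dead: "z \<in> D \<Longrightarrow> gh z = 0 \<and> gv z = 0"
    and dead_not_target: "z \<in> D \<Longrightarrow> z \<notin> A"
    and dead_left: "z \<in> D \<Longrightarrow> step_left z \<in> D"
    and dead_down: "z \<in> D \<Longrightarrow> step_down z \<in> D"
    and harmonic_h: "z \<notin> A \<Longrightarrow> z \<notin> D \<Longrightarrow>
          gh z = b1 * gh (step_left z) + (1 - b1) * gv (step_down z)"
    and harmonic_v: "z \<notin> A \<Longrightarrow> z \<notin> D \<Longrightarrow>
          gv z = b2 * gv (step_down z) + (1 - b2) * gh (step_left z)"
    and rank_left: "z \<notin> A \<Longrightarrow> z \<notin> D \<Longrightarrow> rank (step_left z) < rank z"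
    and rank_down: "z \<notin> A \<Longrightarrow> z \<notin> D \<Longrightarrow> rank (step_down z) < rank z"
begin

text \<open>
  The Markov property in the form needed: given the history up to time \<open>n + 1\<close>, the probability of a
  visit to \<open>A\<close> from then on depends on the last position and the last direction only. The induction is
  on the rank of the last position, splitting over the next step; the history has to be arbitrary,
  since it grows by one point in each application of the induction hypothesis.
\<close>

lemma hitting_probability_given_history:
  assumes prob: "prob_space M"
    and path: "reversed_random_path M b1 b2 p q T"
  shows "(h (Suc n) = step_left (h n) \<longrightarrow>
      \<P>(\<omega> in M. (\<forall>i\<le>Suc n. T i \<omega> = h i) \<and> (\<exists>m\<ge>Suc n. T m \<omega> \<in> A))
        = \<P>(\<omega> in M. \<forall>i\<le>Suc n. T i \<omega> = h i) * gh (h (Suc n))) \<and>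
    (h (Suc n) = step_down (h n) \<longrightarrow>
      \<P>(\<omega> in M. (\<forall>i\<le>Suc n. T i \<omega> = h i) \<and> (\<exists>m\<ge>Suc n. T m \<omega> \<in> A))
        = \<P>(\<omega> in M. \<forall>i\<le>Suc n. T i \<omega> = h i) * gv (h (Suc n)))"
proof (induction "rank (h (Suc n))" arbitrary: n h rule: less_induct)
  case less
  interpret prob_space M by (rule prob)
  have [measurable]: "T n \<in> measurable M (count_space UNIV)" for n
    using path by (rule reversed_random_path_measurable)
  let ?z = "h (Suc n)"
  let ?H = "\<lambda>\<omega>. \<forall>i\<le>Suc n. T i \<omega> = h i"
  consider "?z \<in> A" | "?z \<in> D" | "?z \<notin> A" "?z \<notin> D" by blast
  then show ?case
  proof cases
    case 1
    then have "(?H \<omega> \<and> (\<exists>m\<ge>Suc n. T m \<omega> \<in> A)) = ?H \<omega>" for \<omega>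
      by (metis le_refl)
    with on_target[OF 1] show ?thesis by (simp only: mult_1_right simp_thms)
  next
    case 2
    have "T m \<omega> \<in> D" if "\<omega> \<in> space M" "?H \<omega>" "Suc n \<le> m" for \<omega> m
      using that(3)
    proof (induction m rule: dec_induct)
      case base
      then show ?case using 2 that by simp
    next
      case (step m)
      then show ?case
        using reversed_random_path_step[OF path that(1), of m] dead_left dead_down by metis
    qed
    then have "{\<omega> \<in> space M. ?H \<omega> \<and> (\<exists>m\<ge>Suc n. T m \<omega> \<in> A)} = {}"
      using dead_not_target by blast
    with on_dead[OF 2] show ?thesis by (simp only: measure_empty) simp
  next
    case 3
    define hl where "hl = h(Suc (Suc n) := step_left ?z)"
    define hd where "hd = h(Suc (Suc n) := step_down ?z)"
    let ?Hl = "\<lambda>\<omega>. \<forall>i\<le>Suc (Suc n). T i \<omega> = hl i"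
    let ?Hd = "\<lambda>\<omega>. \<forall>i\<le>Suc (Suc n). T i \<omega> = hd i"
    let ?B = "\<lambda>\<omega>. \<exists>m\<ge>Suc (Suc n). T m \<omega> \<in> A"
    have Hl: "?Hl \<omega> \<longleftrightarrow> ?H \<omega> \<and> T (Suc (Suc n)) \<omega> = step_left ?z" for \<omega>
      by (simp add: hl_def all_conj_distrib le_Suc_eq[of _ "Suc n"] imp_disjL)
    have Hd: "?Hd \<omega> \<longleftrightarrow> ?H \<omega> \<and> T (Suc (Suc n)) \<omega> = step_down ?z" for \<omega>
      by (simp add: hd_def all_conj_distrib le_Suc_eq[of _ "Suc n"] imp_disjL)
    \<comment> \<open>The current point is not in \<open>A\<close>, so the visit happens at the next point or later.\<close>
    have skip: "(\<exists>m\<ge>Suc n. T m \<omega> \<in> A) \<longleftrightarrow> ?B \<omega>" if "?H \<omega>" for \<omega>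
      using 3(1) that by (metis Suc_leD le_antisym not_less_eq_eq order_refl)
    have "{\<omega> \<in> space M. ?H \<omega> \<and> (\<exists>m\<ge>Suc n. T m \<omega> \<in> A)}
        = {\<omega> \<in> space M. ?Hl \<omega> \<and> ?B \<omega>} \<union> {\<omega> \<in> space M. ?Hd \<omega> \<and> ?B \<omega>}"
    proof -
      have "?H \<omega> \<and> (\<exists>m\<ge>Suc n. T m \<omega> \<in> A) \<longleftrightarrow> (?Hl \<omega> \<and> ?B \<omega>) \<or> (?Hd \<omega> \<and> ?B \<omega>)"
        if "\<omega> \<in> space M" for \<omega>
        unfolding Hl Hd
        using skip[of \<omega>] reversed_random_path_step[OF path that, of "Suc n"] by auto
      then show ?thesis by blast
    qed
    moreover have "{\<omega> \<in> space M. ?Hl \<omega> \<and> ?B \<omega>} \<inter> {\<omega> \<in> space M. ?Hd \<omega> \<and> ?B \<omega>} = {}"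
      unfolding Hl Hd using step_left_neq_step_down[of ?z] by auto
    ultimately have split: "\<P>(\<omega> in M. ?H \<omega> \<and> (\<exists>m\<ge>Suc n. T m \<omega> \<in> A))
        = \<P>(\<omega> in M. ?Hl \<omega> \<and> ?B \<omega>) + \<P>(\<omega> in M. ?Hd \<omega> \<and> ?B \<omega>)"
      by (simp add: finite_measure_Union)
    have hlz: "hl (Suc (Suc n)) = step_left ?z" "hl (Suc n) = ?z"
      and hdz: "hd (Suc (Suc n)) = step_down ?z" "hd (Suc n) = ?z"
      by (simp_all add: hl_def hd_def)
    have left: "\<P>(\<omega> in M. ?Hl \<omega> \<and> ?B \<omega>) = \<P>(\<omega> in M. ?Hl \<omega>) * gh (step_left ?z)"
      using less(1)[of hl "Suc n"] rank_left[OF 3] unfolding hlz by blast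
    have down: "\<P>(\<omega> in M. ?Hd \<omega> \<and> ?B \<omega>) = \<P>(\<omega> in M. ?Hd \<omega>) * gv (step_down ?z)"
      using less(1)[of hd "Suc n"] rank_down[OF 3] unfolding hdz by blast
    note extend = reversed_random_path_extend[OF prob path, where h = h and n = n]
    show ?thesis
      unfolding split left down unfolding Hl Hd
    proof (intro conjI impI, goal_cases)
      case 1
      show ?case unfolding extend(1,2)[OF 1] harmonic_h[OF 3] by (simp only: distrib_left mult.assoc)
    next
      case 2
      show ?case unfolding extend(3,4)[OF 2] harmonic_v[OF 3]
        by (simp only: distrib_left mult.assoc add.commute)
    qed
  qed
qed

lemma hitting_probability:
  assumes prob: "prob_space M"
    and path: "reversed_random_path M b1 b2 p q T"
    and "p \<notin> A"
  shows "q = step_left p \<Longrightarrow> \<P>(\<omega> in M. \<exists>n. T n \<omega> \<in> A) = gh q"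
    and "q = step_down p \<Longrightarrow> \<P>(\<omega> in M. \<exists>n. T n \<omega> \<in> A) = gv q"
proof -
  interpret prob_space M by (rule prob)
  define h where "h = (\<lambda>n::nat. if n = 0 then p else q)"
  have start: "T 0 \<omega> = p" "T 1 \<omega> = q" if "\<omega> \<in> space M" for \<omega>
    using path that unfolding reversed_random_path_def by blast+
  have hist: "\<forall>i\<le>Suc 0. T i \<omega> = h i" if "\<omega> \<in> space M" for \<omega>
    using start[OF that] by (auto simp: h_def le_Suc_eq)
  have "{\<omega> \<in> space M. \<forall>i\<le>Suc 0. T i \<omega> = h i} = space M"
    using hist by blast
  then have one: "\<P>(\<omega> in M. \<forall>i\<le>Suc 0. T i \<omega> = h i) = 1"
    by (simp only: prob_space)
  have late: "(\<exists>n. T n \<omega> \<in> A) \<longleftrightarrow> (\<exists>m\<ge>Suc 0. T m \<omega> \<in> A)" if "\<omega> \<in> space M" for \<omega>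
    using start(1)[OF that] \<open>p \<notin> A\<close> by (metis One_nat_def Suc_leI neq0_conv)
  have "{\<omega> \<in> space M. \<exists>n. T n \<omega> \<in> A}
      = {\<omega> \<in> space M. (\<forall>i\<le>Suc 0. T i \<omega> = h i) \<and> (\<exists>m\<ge>Suc 0. T m \<omega> \<in> A)}"
    using hist late by blast
  with hitting_probability_given_history[OF prob path, of h 0] one
  show "q = step_left p \<Longrightarrow> \<P>(\<omega> in M. \<exists>n. T n \<omega> \<in> A) = gh q"
    and "q = step_down p \<Longrightarrow> \<P>(\<omega> in M. \<exists>n. T n \<omega> \<in> A) = gv q"
    by (simp_all add: h_def)
qed

end

text \<open>
  The probabilities of hitting a half-line at distance \<open>i\<close> whose end is passed by the \<open>(j + 1)\<close>-st
  transverse step. The function \<open>hit_along\<close> is for a path that arrived moving towards the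
  half-line, and repeats such a step with probability \<open>a\<close>; \<open>hit_across\<close> is for a path that arrived
  moving transversally, and repeats that with probability \<open>c\<close>. With directions relative to the target,
  one definition serves for columns and, with the parameters exchanged, for rows. At \<open>j = 0\<close> the term
  for a transverse step is missing because that step passes the end of the half-line.
\<close>

fun hit_along hit_across :: "real \<Rightarrow> real \<Rightarrow> nat \<Rightarrow> nat \<Rightarrow> real" where
  "hit_along a c 0 j = 1"
| "hit_along a c (Suc i) 0 = a * hit_along a c i 0"
| "hit_along a c (Suc i) (Suc j) = a * hit_along a c i (Suc j) + (1 - a) * hit_across a c (Suc i) j"
| "hit_across a c 0 j = 1"
| "hit_across a c (Suc i) 0 = (1 - c) * hit_along a c i 0"
| "hit_across a c (Suc i) (Suc j) = c * hit_across a c (Suc i) j + (1 - c) * hit_along a c i (Suc j)"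

lemma hitting_column:
  fixes x y :: int
  shows "absorbed_harmonic b1 b2 {z. fst z = x \<and> y \<le> snd z} {z. fst z < x \<or> snd z < y}
    (\<lambda>z. if fst z < x \<or> snd z < y then 0 else hit_along b1 b2 (nat (fst z - x)) (nat (snd z - y)))
    (\<lambda>z. if fst z < x \<or> snd z < y then 0 else hit_across b1 b2 (nat (fst z - x)) (nat (snd z - y)))
    (\<lambda>z. nat (fst z - x) + nat (snd z - y + 1))"
    (is "absorbed_harmonic _ _ ?A ?D ?gh ?gv ?r")
proof
  fix z assume z: "z \<notin> ?A" "z \<notin> ?D"
  define i where "i = nat (fst z - x - 1)"
  have zi: "nat (fst z - x) = Suc i" "nat (fst z - x - 1) = i"
    using z by (auto simp: i_def nat_diff_distrib)
  have "?gh z = b1 * ?gh (step_left z) + (1 - b1) * ?gv (step_down z) \<and>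
        ?gv z = b2 * ?gv (step_down z) + (1 - b2) * ?gh (step_left z)"
  proof (cases "snd z = y")
    case True
    then show ?thesis using z zi
      by (auto simp: step_left_def step_down_def algebra_simps)
  next
    case False
    define j where "j = nat (snd z - y - 1)"
    have zj: "nat (snd z - y) = Suc j" "nat (snd z - y - 1) = j"
      using z False by (auto simp: j_def)
    have arg: "fst z - 1 - x = fst z - x - 1" "snd z - 1 - y = snd z - y - 1" by auto
    show ?thesis using z False
      by (auto simp: step_left_def step_down_def zi zj arg)
  qed
  then show "?gh z = b1 * ?gh (step_left z) + (1 - b1) * ?gv (step_down z)"
    and "?gv z = b2 * ?gv (step_down z) + (1 - b2) * ?gh (step_left z)"
    by blast+
qed (auto simp: step_left_def step_down_def)

text \<open>
  The image of \<open>hitting_column\<close> under reflection in the diagonal, which exchanges the two directions,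
  hence \<open>b1\<close> with \<open>b2\<close> and \<open>gh\<close> with \<open>gv\<close>.
\<close>

lemma hitting_row:
  fixes x y :: int
  shows "absorbed_harmonic b1 b2 {z. snd z = y \<and> x \<le> fst z} {z. fst z < x \<or> snd z < y}
    (\<lambda>z. if fst z < x \<or> snd z < y then 0 else hit_across b2 b1 (nat (snd z - y)) (nat (fst z - x)))
    (\<lambda>z. if fst z < x \<or> snd z < y then 0 else hit_along b2 b1 (nat (snd z - y)) (nat (fst z - x)))
    (\<lambda>z. nat (fst z - x + 1) + nat (snd z - y))"
proof -
  interpret swapped: absorbed_harmonic b2 b1
    "{z. fst z = y \<and> x \<le> snd z}" "{z. fst z < y \<or> snd z < x}"
    "\<lambda>z. if fst z < y \<or> snd z < x then 0 else hit_along b2 b1 (nat (fst z - y)) (nat (snd z - x))"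
    "\<lambda>z. if fst z < y \<or> snd z < x then 0 else hit_across b2 b1 (nat (fst z - y)) (nat (snd z - x))"
    "\<lambda>z. nat (fst z - y) + nat (snd z - x + 1)"
    by (rule hitting_column)
  show ?thesis
  proof (unfold_locales, goal_cases)
    case (6 z)
    then show ?case
      using swapped.harmonic_v[of "prod.swap z"] by (simp add: step_left_def step_down_def disj_commute)
  next
    case (7 z)
    then show ?case
      using swapped.harmonic_h[of "prod.swap z"] by (simp add: step_left_def step_down_def disj_commute)
  qed (auto simp: step_left_def step_down_def)
qed

section \<open>The Green function of the four-point equation\<close>

text \<open>
  Elimination of \<open>hit_across\<close>: the equation for \<open>hit_along (i + 1) (j + 1)\<close> contains
  \<open>(1 - a) * hit_across (i + 1) j\<close>. One more step turns this into \<open>hit_across (i + 1) (j - 1)\<close>, which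
  the equation for \<open>hit_along (i + 1) j\<close> expresses by values of \<open>hit_along\<close>. For \<open>j = 0\<close> both
  contributions of a transverse step vanish, and the same identity results.
\<close>

lemma hit_along_recurrence:
  "hit_along a c (Suc i) (Suc j) - a * hit_along a c i (Suc j) - c * hit_along a c (Suc i) j
     + (a + c - 1) * hit_along a c i j = 0"
  by (cases j) (simp_all add: algebra_simps)

lemma hit_along_0_right: "hit_along a c i 0 = a ^ i"
  by (induction i) simp_all

definition green :: "real \<Rightarrow> real \<Rightarrow> nat \<Rightarrow> nat \<Rightarrow> real" where
  "green b1 b2 i j = hit_along b1 b2 i j + hit_along b2 b1 j i - 1"

lemma green_recurrence:
  "green b1 b2 (Suc i) (Suc j) - b1 * green b1 b2 i (Suc j) - b2 * green b1 b2 (Suc i) j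
     + (b1 + b2 - 1) * green b1 b2 i j = 0"
  using hit_along_recurrence[of b1 b2 i j] hit_along_recurrence[of b2 b1 j i]
  by (simp add: green_def algebra_simps del: hit_along.simps)

lemma green_0_left: "green b1 b2 0 j = b2 ^ j"
  by (simp add: green_def hit_along_0_right)

lemma green_0_right: "green b1 b2 i 0 = b1 ^ i"
  by (simp add: green_def hit_along_0_right)

text \<open>
  In the four shifted sums, the terms with \<open>x \<le> X\<close> and \<open>y \<le> Y\<close> cancel by the homogeneous equation for
  the Green function. The terms with \<open>y = Y + 1\<close> occur in two of the sums only, and cancel because the
  Green function is geometric with ratio \<open>b1\<close> on that side; likewise those with \<open>x = X + 1\<close> and ratio
  \<open>b2\<close>. The corner term, with weight \<open>1\<close>, is what survives.
\<close>

lemma green_convolution_recurrence: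
  fixes u :: "nat \<Rightarrow> nat \<Rightarrow> real" and b1 b2 :: real
  defines "S \<equiv> \<lambda>X Y. \<Sum>x=1..X. \<Sum>y=1..Y. u x y * green b1 b2 (X - x) (Y - y)"
  shows "S (Suc X) (Suc Y) - b1 * S X (Suc Y) - b2 * S (Suc X) Y + (b1 + b2 - 1) * S X Y
    = u (Suc X) (Suc Y)"
proof -
  let ?g = "green b1 b2"
  let ?in = "\<lambda>f. \<Sum>x=1..X. \<Sum>y=1..Y. u x y * f (X - x) (Y - y)"
  let ?top = "\<Sum>x=1..X. u x (Suc Y) * b1 ^ (X - x)"
  let ?right = "\<Sum>y=1..Y. u (Suc X) y * b2 ^ (Y - y)"
  have S11: "S (Suc X) (Suc Y) = ?in (\<lambda>i j. ?g (Suc i) (Suc j)) + b1 * ?top + b2 * ?right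
      + u (Suc X) (Suc Y)"
    unfolding S_def
    by (simp add: Suc_diff_le green_0_left green_0_right sum.distrib sum_distrib_left mult_ac)
  have S01: "S X (Suc Y) = ?in (\<lambda>i j. ?g i (Suc j)) + ?top"
    unfolding S_def
    by (simp add: Suc_diff_le green_0_left green_0_right sum.distrib)
  have S10: "S (Suc X) Y = ?in (\<lambda>i j. ?g (Suc i) j) + ?right"
    unfolding S_def
    by (simp add: Suc_diff_le green_0_left green_0_right sum.distrib)
  have "?in (\<lambda>i j. ?g (Suc i) (Suc j)) - b1 * ?in (\<lambda>i j. ?g i (Suc j)) - b2 * ?in (\<lambda>i j. ?g (Suc i) j)
      + (b1 + b2 - 1) * ?in ?g
      = (\<Sum>x=1..X. \<Sum>y=1..Y. u x y * (?g (Suc (X - x)) (Suc (Y - y)) - b1 * ?g (X - x) (Suc (Y - y))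
          - b2 * ?g (Suc (X - x)) (Y - y) + (b1 + b2 - 1) * ?g (X - x) (Y - y)))"
    unfolding sum_distrib_left sum.distrib[symmetric] sum_subtractf[symmetric]
    by (intro sum.cong refl) (simp add: algebra_simps)
  also have "\<dots> = 0"
    by (simp only: green_recurrence mult_zero_right sum.neutral_const)
  finally show ?thesis
    unfolding S11 S01 S10 by (simp add: S_def algebra_simps)
qed

lemma four_point_solution:
  fixes \<Phi> u :: "nat \<Rightarrow> nat \<Rightarrow> real"
  assumes eqn: "\<And>x y. \<Phi> (x + 1) (y + 1) - b1 * \<Phi> x (y + 1) - b2 * \<Phi> (x + 1) y
                  + (b1 + b2 - 1) * \<Phi> x y = u (x + 1) (y + 1)"
    and "\<And>x. \<Phi> x 0 = 0" and "\<And>y. \<Phi> 0 y = 0"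
  shows "\<Phi> X Y = (\<Sum>x=1..X. \<Sum>y=1..Y. u x y * green b1 b2 (X - x) (Y - y))"
proof (induction X arbitrary: Y)
  case 0
  then show ?case using assms by simp
next
  case (Suc X)
  show ?case
  proof (induction Y)
    case 0
    then show ?case using assms by simp
  next
    case IH: (Suc Y)
    show ?case
      using eqn[of X Y] green_convolution_recurrence[of u b1 b2 X Y]
        Suc[of Y] Suc[of "Suc Y"] IH
      by (simp del: sum.cl_ivl_Suc)
  qed
qed

section \<open>The expectation\<close>

text \<open>
  The starting point \<open>(X + 1, Y)\<close> lies to the right of every column \<open>x \<le> X\<close>, so it does not contribute
  a visit, and the path may be regarded as starting at \<open>(X, Y)\<close> with a horizontal arrival.
\<close>

lemma probability_weakly_below:
  assumes prob: "prob_space M"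
    and path: "reversed_random_path M b1 b2 (X + 1, Y) (X, Y) T"
    and le: "x \<le> X" "y \<le> Y"
  shows "{\<omega> \<in> space M. weakly_below (x, y) (curve (\<lambda>n. T n \<omega>))} \<in> sets M"
    and "\<P>(\<omega> in M. weakly_below (x, y) (curve (\<lambda>n. T n \<omega>)))
      = hit_along b1 b2 (nat (X - x)) (nat (Y - y))"
proof -
  let ?A = "{z :: int \<times> int. fst z = x \<and> y \<le> snd z}"
  interpret column: absorbed_harmonic b1 b2 ?A "{z. fst z < x \<or> snd z < y}"
    "\<lambda>z. if fst z < x \<or> snd z < y then 0 else hit_along b1 b2 (nat (fst z - x)) (nat (snd z - y))"
    "\<lambda>z. if fst z < x \<or> snd z < y then 0 else hit_across b1 b2 (nat (fst z - x)) (nat (snd z - y))"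
    "\<lambda>z. nat (fst z - x) + nat (snd z - y + 1)"
    by (rule hitting_column)
  have visits: "{\<omega> \<in> space M. weakly_below (x, y) (curve (\<lambda>n. T n \<omega>))}
      = {\<omega> \<in> space M. \<exists>n. T n \<omega> \<in> ?A}"
    using weakly_below_curve_iff reversed_random_path_step[OF path] by auto
  show "{\<omega> \<in> space M. weakly_below (x, y) (curve (\<lambda>n. T n \<omega>))} \<in> sets M"
    unfolding visits using path by (rule reversed_random_path_visits_sets)
  show "\<P>(\<omega> in M. weakly_below (x, y) (curve (\<lambda>n. T n \<omega>)))
      = hit_along b1 b2 (nat (X - x)) (nat (Y - y))"
    unfolding visits
    using column.hitting_probability(1)[OF prob path] le by (simp add: step_left_def)
qed

lemma probability_weakly_left:
  assumes prob: "prob_space M"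
    and path: "reversed_random_path M b1 b2 (X, Y + 1) (X, Y) T"
    and le: "x \<le> X" "y \<le> Y"
  shows "{\<omega> \<in> space M. weakly_left (x, y) (curve (\<lambda>n. T n \<omega>))} \<in> sets M"
    and "\<P>(\<omega> in M. weakly_left (x, y) (curve (\<lambda>n. T n \<omega>)))
      = hit_along b2 b1 (nat (Y - y)) (nat (X - x))"
proof -
  let ?A = "{z :: int \<times> int. snd z = y \<and> x \<le> fst z}"
  interpret row: absorbed_harmonic b1 b2 ?A "{z. fst z < x \<or> snd z < y}"
    "\<lambda>z. if fst z < x \<or> snd z < y then 0 else hit_across b2 b1 (nat (snd z - y)) (nat (fst z - x))"
    "\<lambda>z. if fst z < x \<or> snd z < y then 0 else hit_along b2 b1 (nat (snd z - y)) (nat (fst z - x))"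
    "\<lambda>z. nat (fst z - x + 1) + nat (snd z - y)"
    by (rule hitting_row)
  have visits: "{\<omega> \<in> space M. weakly_left (x, y) (curve (\<lambda>n. T n \<omega>))}
      = {\<omega> \<in> space M. \<exists>n. T n \<omega> \<in> ?A}"
    using weakly_left_curve_iff reversed_random_path_step[OF path] by auto
  show "{\<omega> \<in> space M. weakly_left (x, y) (curve (\<lambda>n. T n \<omega>))} \<in> sets M"
    unfolding visits using path by (rule reversed_random_path_visits_sets)
  show "\<P>(\<omega> in M. weakly_left (x, y) (curve (\<lambda>n. T n \<omega>)))
      = hit_along b2 b1 (nat (Y - y)) (nat (X - x))"
    unfolding visits
    using row.hitting_probability(2)[OF prob path] le by (simp add: step_down_def)
qed

lemma expectation_of_bool:
  assumes "prob_space M" "{\<omega> \<in> space M. P \<omega>} \<in> sets M"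
  shows "integrable M (\<lambda>\<omega>. of_bool (P \<omega>) :: real)"
    and "(\<integral>\<omega>. of_bool (P \<omega>) \<partial>M) = \<P>(\<omega> in M. P \<omega>)"
proof -
  interpret prob_space M by fact
  have "integrable M (indicator {\<omega> \<in> space M. P \<omega>} :: _ \<Rightarrow> real)"
    using assms(2) by (simp add: less_top[symmetric])
  also have "?this \<longleftrightarrow> integrable M (\<lambda>\<omega>. of_bool (P \<omega>) :: real)"
    by (intro Bochner_Integration.integrable_cong) auto
  finally show "integrable M (\<lambda>\<omega>. of_bool (P \<omega>) :: real)" .
  have "(\<integral>\<omega>. of_bool (P \<omega>) \<partial>M) = (\<integral>\<omega>. indicator {\<omega> \<in> space M. P \<omega>} \<omega> \<partial>M :: real)"
    by (intro Bochner_Integration.integral_cong) auto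
  also have "\<dots> = \<P>(\<omega> in M. P \<omega>)"
    using assms(2) by simp
  finally show "(\<integral>\<omega>. of_bool (P \<omega>) \<partial>M) = \<P>(\<omega> in M. P \<omega>)" .
qed

lemma expectation_I_between:
  assumes prob: "prob_space M"
    and H: "reversed_random_path M b1 b2 (int X + 1, int Y) (int X, int Y) TH"
    and V: "reversed_random_path M b1 b2 (int X, int Y + 1) (int X, int Y) TV"
    and le: "x \<le> X" "y \<le> Y"
  shows "integrable M (\<lambda>\<omega>. I_between (\<lambda>n. TH n \<omega>) (\<lambda>n. TV n \<omega>) x y)"
    and "(\<integral>\<omega>. I_between (\<lambda>n. TH n \<omega>) (\<lambda>n. TV n \<omega>) x y \<partial>M) = green b1 b2 (X - x) (Y - y)"
proof -
  interpret prob_space M by (rule prob)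
  have le': "int x \<le> int X" "int y \<le> int Y" using le by auto
  note below = probability_weakly_below[OF prob H le'] and left = probability_weakly_left[OF prob V le']
  note eb = expectation_of_bool[OF prob below(1)] and el = expectation_of_bool[OF prob left(1)]
  show "integrable M (\<lambda>\<omega>. I_between (\<lambda>n. TH n \<omega>) (\<lambda>n. TV n \<omega>) x y)"
    unfolding I_between_def using eb(1) el(1) by simp
  have "nat (int X - int x) = X - x" "nat (int Y - int y) = Y - y" by auto
  then show "(\<integral>\<omega>. I_between (\<lambda>n. TH n \<omega>) (\<lambda>n. TV n \<omega>) x y \<partial>M) = green b1 b2 (X - x) (Y - y)"
    unfolding I_between_def green_def using eb el below(2) left(2) by (simp add: prob_space)
qed

theorem theorem4p9:
  fixes b1 b2 :: real
    and u \<Phi> :: "nat \<Rightarrow> nat \<Rightarrow> real"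
    and X Y :: nat
    and M :: "'a measure"
    and TH TV :: "nat \<Rightarrow> 'a \<Rightarrow> int \<times> int"
  assumes "b1 \<noteq> b2" and "0 < b1" and "b1 < 1" and "0 < b2" and "b2 < 1"
    and "\<And>x y. \<Phi> (x + 1) (y + 1) - b1 * \<Phi> x (y + 1) - b2 * \<Phi> (x + 1) y
                  + (b1 + b2 - 1) * \<Phi> x y = u (x + 1) (y + 1)"
    and "\<And>x. \<Phi> x 0 = 0" and "\<And>y. \<Phi> 0 y = 0"
    and "prob_space M"
    and "reversed_random_path M b1 b2 (int X + 1, int Y) (int X, int Y) TH"
    and "reversed_random_path M b1 b2 (int X, int Y + 1) (int X, int Y) TV"
  shows "\<Phi> X Y = (\<integral>\<omega>. (\<Sum>x=1..X. \<Sum>y=1..Y. u x y * I_between (\<lambda>n. TH n \<omega>) (\<lambda>n. TV n \<omega>) x y) \<partial>M)"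
proof -
  note between = expectation_I_between[OF assms(9,10,11)]
  have int: "integrable M (\<lambda>\<omega>. u x y * I_between (\<lambda>n. TH n \<omega>) (\<lambda>n. TV n \<omega>) x y)"
    if "x \<in> {1..X}" "y \<in> {1..Y}" for x y
    using that by (intro integrable_mult_right between(1)) auto
  have "\<Phi> X Y = (\<Sum>x=1..X. \<Sum>y=1..Y. u x y * green b1 b2 (X - x) (Y - y))"
    using assms(6,7,8) by (rule four_point_solution)
  also have "\<dots> = (\<Sum>x=1..X. \<Sum>y=1..Y. \<integral>\<omega>. u x y * I_between (\<lambda>n. TH n \<omega>) (\<lambda>n. TV n \<omega>) x y \<partial>M)"
    by (intro sum.cong refl) (simp add: between)
  also have "\<dots> = (\<Sum>x=1..X. \<integral>\<omega>. (\<Sum>y=1..Y. u x y * I_between (\<lambda>n. TH n \<omega>) (\<lambda>n. TV n \<omega>) x y) \<partial>M)"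
    by (rule sum.cong[OF refl], rule Bochner_Integration.integral_sum[symmetric], rule int)
  also have "\<dots> = (\<integral>\<omega>. (\<Sum>x=1..X. \<Sum>y=1..Y. u x y * I_between (\<lambda>n. TH n \<omega>) (\<lambda>n. TV n \<omega>) x y) \<partial>M)"
    by (rule Bochner_Integration.integral_sum[symmetric], rule Bochner_Integration.integrable_sum, rule int)
  finally show ?thesis .
qed

end
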